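(* Let $n\ge 3$ be odd and let $A\in\mathbb{R}^{(n-1)\times n}$ be a Mercedes-Benz frame, i.e. a matrix whose $n$ columns form an equiangular tight frame in $\mathbb{R}^{n-1}$, whose kernel is spanned by the all-ones vector (equivalently, each row of $A$ has mean value zero). Then $$\Lambda(A,n-1)=\left(\frac{n+1}{2}\right)\binom{n}{\frac{n-1}{2}}.$$
   Context: For $A\in\mathbb{R}^{m\times n}$ with $m\le n$ and $I\subset\{1,\dots,n\}$, $A_I$ denotes the submatrix of $A$ formed by the columns indexed by $I$, $A_I^T$ its transpose, and $I^c=\{1,\dots,n\}\setminus I$. "$A_I$ has full rank" means that its columns are linearly independent. A pair $(I,s)$ with $I\subset\{1,\dots,n\}$, $|I|\le m$, and $s\in\{-1,1\}^I$ is a Recoverable Support of $A$ of size $|I|$ if $A_I$ has full rank and there exists $w\in\mathbb{R}^m$ with $A_I^Tw=s$ and $\|A_{I^c}^Tw\|_\infty<1$. $\Lambda(A,k)$ denotes the number of Recoverable Supports $(I,s)$ of $A$ with size $k$. *)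

theory Defs
  imports "HOL-Analysis.Analysis"
begin

text \<open>The index sets of rows and columns are the finite types \<open>'m\<close> and \<open>'n\<close>.
  The paper's \<open>m\<close> and \<open>n\<close> are their cardinalities.\<close>

definition full_rank_cols :: "real^'n^'m \<Rightarrow> 'n set \<Rightarrow> bool" where
  "full_rank_cols A I \<longleftrightarrow>
     inj_on (\<lambda>i. column i A) I \<and> independent ((\<lambda>i. column i A) ` I)"

text \<open>A sign vector in \<open>{-1,1}\<^sup>I\<close> is an extensional function on \<open>I\<close>, so that distinct
  functions are distinct sign vectors. The entries of \<open>A\<^sub>I\<^sup>T w\<close> are those entries of
  \<open>A\<^sup>T w\<close> whose index lies in \<open>I\<close>. The vector for the complement of \<open>I\<close> is padded with
  zeros on \<open>I\<close>, which leaves its maximum norm unchanged (also when the complement is empty).\<close>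

definition recoverable_support :: "real^'n^'m \<Rightarrow> 'n set \<Rightarrow> ('n \<Rightarrow> real) \<Rightarrow> bool" where
  "recoverable_support A I s \<longleftrightarrow>
     card I \<le> CARD('m) \<and> s \<in> I \<rightarrow>\<^sub>E {-1, 1} \<and> full_rank_cols A I \<and>
     (\<exists>w :: real^'m.
        (\<forall>i\<in>I. (transpose A *v w) $ i = s i) \<and>
        infnorm (\<chi> i. if i \<in> I then 0 else (transpose A *v w) $ i) < 1)"

definition num_recoverable_supports :: "real^'n^'m \<Rightarrow> nat \<Rightarrow> nat" where
  "num_recoverable_supports A k = card {(I, s). recoverable_support A I s \<and> card I = k}"

lemma finite_recoverable_supports:
  fixes A :: "real^'n^'m"
  shows "finite {(I, s). recoverable_support A I s \<and> card I = k}"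
proof (rule finite_subset)
  show "{(I, s). recoverable_support A I s \<and> card I = k}
          \<subseteq> Sigma UNIV (\<lambda>I. I \<rightarrow>\<^sub>E {-1, 1 :: real})"
    by (auto simp: recoverable_support_def)
  show "finite (Sigma (UNIV :: 'n set set) (\<lambda>I. I \<rightarrow>\<^sub>E {-1, 1 :: real}))"
    by (intro finite_SigmaI finite_PiE) auto
qed

definition tight_frame :: "('n::finite \<Rightarrow> 'a::euclidean_space) \<Rightarrow> bool" where
  "tight_frame a \<longleftrightarrow> (\<exists>c>0. \<forall>x. (\<Sum>i\<in>UNIV. (a i \<bullet> x)\<^sup>2) = c * (norm x)\<^sup>2)"

text \<open>Equal norms are required, but not the normalisation to norm one: the unit-norm
  convention is the case \<open>r = 1\<close>.\<close>

definition equiangular :: "('n \<Rightarrow> 'a::euclidean_space) \<Rightarrow> bool" where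
  "equiangular a \<longleftrightarrow>
     (\<exists>r>0. \<forall>i. norm (a i) = r) \<and> (\<exists>\<mu>. \<forall>i j. i \<noteq> j \<longrightarrow> \<bar>a i \<bullet> a j\<bar> = \<mu>)"

definition mercedes_benz_frame :: "real^'n^'m \<Rightarrow> bool" where
  "mercedes_benz_frame A \<longleftrightarrow>
     CARD('n) = CARD('m) + 1 \<and>
     equiangular (\<lambda>i. column i A) \<and> tight_frame (\<lambda>i. column i A) \<and>
     {x. A *v x = 0} = span {\<chi> i. 1}"

end

theory Submission
  imports Defs
begin

text \<open>
  Since the kernel is spanned by the all-ones vector, any \<open>n - 1\<close> columns are linearly independent,
  and the range of \<open>A\<^sup>T\<close> consists of the vectors with entry sum zero. So a sign vector \<open>s\<close> on the
  complement of \<open>{j}\<close> forces \<open>(A\<^sup>T w)\<^sub>j = - sum s\<close>. As \<open>n - 1\<close> is even this is an even integer, and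
  it has modulus below one only if it vanishes, i.e. if \<open>s\<close> has as many positive as negative entries.
  This gives \<open>n\<close> times \<open>n - 1 choose (n - 1) / 2\<close> pairs.
\<close>

text \<open>The range of the transpose is the orthogonal complement of the kernel, here of the
  all-ones vector. One direction is the adjoint identity. For the other, \<open>y\<close> is split
  as \<open>p + q\<close> with \<open>p\<close> in the range and \<open>q\<close> orthogonal to it;
  \<open>q\<close> then lies in the kernel, so it is constant, and the vanishing sum kills
  it.\<close>

lemma in_range_transpose_iff:
  fixes A :: "real^'n^'m"
  assumes ker: "{x. A *v x = 0} = span {\<chi> i. 1}"
  shows "y \<in> range ((*v) (transpose A)) \<longleftrightarrow> (\<Sum>i\<in>UNIV. y $ i) = 0"
proof -
  have one: "A *v (\<chi> i. 1) = 0"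
    using ker span_base[of "\<chi> i. 1" "{\<chi> i. 1} :: (real^'n) set"] by blast
  have adj: "(transpose A *v w) \<bullet> x = w \<bullet> (A *v x)" for w x
    by (metis dot_lmul_matrix transpose_matrix_vector)
  have sum_inner: "(\<Sum>i\<in>UNIV. v $ i) = v \<bullet> (\<chi> i. 1)" for v :: "real^'n"
    by (simp add: inner_vec_def)
  have sum0: "(\<Sum>i\<in>UNIV. (transpose A *v w) $ i) = 0" for w
    unfolding sum_inner adj one by simp
  show ?thesis
  proof
    assume "(\<Sum>i\<in>UNIV. y $ i) = 0"
    define R where "R = range ((*v) (transpose A))"
    have "subspace R"
      unfolding R_def by (intro linear_subspace_image) auto
    obtain p q where p: "p \<in> span R" and q: "\<And>w. w \<in> span R \<Longrightarrow> orthogonal q w"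
      and y: "y = p + q"
      using orthogonal_subspace_decomp_exists[of R y] by metis
    have pR: "p \<in> R"
      using p \<open>subspace R\<close> span_eq_iff by blast
    have "w \<bullet> (A *v q) = 0" for w
    proof -
      have "transpose A *v w \<in> span R"
        unfolding R_def by (intro span_base) simp
      then show ?thesis
        using q adj by (metis inner_commute orthogonal_def)
    qed
    \<comment> \<open>Take \<open>w = A *v q\<close>.\<close>
    then have "A *v q = 0"
      using inner_eq_zero_iff by blast
    then obtain c where c: "q = c *\<^sub>R (\<chi> i. 1)"
      using ker span_singleton[of "(\<chi> i. 1) :: real^'n"] by blast
    have "(\<Sum>i\<in>UNIV. p $ i) = 0"
      using pR sum0 unfolding R_def by auto
    then have "(\<Sum>i\<in>UNIV. q $ i) = 0"
      using \<open>(\<Sum>i\<in>UNIV. y $ i) = 0\<close> y by (simp add: sum.distrib)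
    \<comment> \<open>The entry sum of \<open>q\<close> is \<open>c * CARD('n)\<close>, hence
      \<open>c = 0\<close>.\<close>
    then have "q = 0"
      using c by simp
    then show "y \<in> range ((*v) (transpose A))"
      using pR y R_def by simp
  qed (use sum0 in auto)
qed

text \<open>A constant vector with a zero entry is zero. So \<open>A\<close> is injective on the
  span of the axis vectors other than the one at \<open>j\<close>, and it carries them to distinct,
  independent columns.\<close>

lemma full_rank_cols_Compl_singleton:
  fixes A :: "real^'n^'m"
  assumes ker: "{x. A *v x = 0} = span {\<chi> i. 1}"
  shows "full_rank_cols A (UNIV - {j})"
proof -
  let ?I = "UNIV - {j}" and ?e = "\<lambda>i. axis i (1::real) :: real^'n"
  have col: "column i A = A *v ?e i" for i
    by (simp add: matrix_vector_mult_basis)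
  have "subspace {x :: real^'n. x $ j = 0}"
    by (auto simp: subspace_def)
  then have sub: "span (?e ` ?I) \<subseteq> {x. x $ j = 0}"
    by (intro span_minimal) (auto simp: axis_def)
  have inj: "inj_on ((*v) A) (span (?e ` ?I))"
  proof (rule inj_onI)
    fix x y assume "x \<in> span (?e ` ?I)" "y \<in> span (?e ` ?I)" and eq: "A *v x = A *v y"
    then have "x $ j = 0" "y $ j = 0"
      using sub by blast+
    then have j: "(x - y) $ j = 0"
      by simp
    have "A *v (x - y) = 0"
      using eq by (simp add: matrix_vector_mult_diff_distrib)
    then obtain c where c: "x - y = c *\<^sub>R (\<chi> i. 1)"
      using ker span_singleton[of "(\<chi> i. 1) :: real^'n"] by blast
    then have "c = 0"
      using j by simp
    then show "x = y"
      using c by simp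
  qed
  have "independent (?e ` ?I)"
    by (rule independent_mono[OF independent_Basis]) (auto simp: Basis_vec_def)
  then have "independent ((*v) A ` ?e ` ?I)"
    using inj by (intro linear_independent_injective_image) auto
  moreover have "inj_on ((*v) A \<circ> ?e) ?I"
  proof (rule comp_inj_on)
    show "inj_on ?e ?I"
      by (auto simp: inj_on_def axis_eq_axis)
    show "inj_on ((*v) A) (?e ` ?I)"
      by (rule inj_on_subset[OF inj span_superset])
  qed
  ultimately show ?thesis
    by (simp add: full_rank_cols_def col image_image o_def)
qed

text \<open>Each sign is twice the indicator of being \<open>1\<close>, minus one. This turns a
  condition on the sum into one on the number of positive entries.\<close>

lemma sum_signs:
  fixes s :: "'a \<Rightarrow> real"
  assumes "finite I" and "s \<in> I \<rightarrow> {-1, 1}"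
  shows "(\<Sum>i\<in>I. s i) = 2 * real (card {i \<in> I. s i = 1}) - real (card I)"
proof -
  have "(\<Sum>i\<in>I. s i) = (\<Sum>i\<in>I. 2 * (if s i = 1 then 1 else 0) - 1)"
    using assms(2) by (intro sum.cong) auto
  also have "\<dots> = 2 * (\<Sum>i\<in>I. if s i = 1 then 1 else 0) - real (card I)"
    by (simp add: sum_subtractf sum_distrib_left)
  also have "(\<Sum>i\<in>I. if s i = 1 then 1 else 0) = real (card {i \<in> I. s i = 1})"
    using assms(1) by (simp add: sum.If_cases Int_def)
  finally show ?thesis .
qed

text \<open>A sign vector is determined by its set of positive entries, and every subset of
  \<open>I\<close> arises as such a set.\<close>

lemma card_sign_vectors:
  assumes "finite I"
  shows "card {s \<in> I \<rightarrow>\<^sub>E {-1, 1 :: real}. card {i \<in> I. s i = 1} = k} = card I choose k"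
proof -
  have "bij_betw (\<lambda>s. {i \<in> I. s i = 1}) {s \<in> I \<rightarrow>\<^sub>E {-1, 1 :: real}. card {i \<in> I. s i = 1} = k}
          {P. P \<subseteq> I \<and> card P = k}"
  proof (rule bij_betw_byWitness[where f' = "\<lambda>P. \<lambda>i\<in>I. if i \<in> P then 1 else -1"])
    have pos: "{i \<in> I. (\<lambda>i\<in>I. if i \<in> P then 1 else - 1 :: real) i = 1} = P" if "P \<subseteq> I" for P
      using that by auto
    show "\<forall>P\<in>{P. P \<subseteq> I \<and> card P = k}.
            {i \<in> I. (\<lambda>i\<in>I. if i \<in> P then 1 else - 1 :: real) i = 1} = P"
      using pos by blast
    show "(\<lambda>P. \<lambda>i\<in>I. if i \<in> P then 1 else - 1) ` {P. P \<subseteq> I \<and> card P = k}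
            \<subseteq> {s \<in> I \<rightarrow>\<^sub>E {-1, 1 :: real}. card {i \<in> I. s i = 1} = k}"
    proof (intro image_subsetI CollectI conjI)
      fix P assume P: "P \<in> {P. P \<subseteq> I \<and> card P = k}"
      show "(\<lambda>i\<in>I. if i \<in> P then 1 else - 1) \<in> I \<rightarrow>\<^sub>E {-1, 1 :: real}"
        by auto
      show "card {i \<in> I. (\<lambda>i\<in>I. if i \<in> P then 1 else - 1 :: real) i = 1} = k"
        using P pos by simp
    qed
  next
    show "\<forall>s\<in>{s \<in> I \<rightarrow>\<^sub>E {-1, 1 :: real}. card {i \<in> I. s i = 1} = k}.
            (\<lambda>i\<in>I. if i \<in> {i \<in> I. s i = 1} then 1 else - 1) = s"
    proof (intro ballI ext)
      fix s i assume "s \<in> {s \<in> I \<rightarrow>\<^sub>E {-1, 1 :: real}. card {i \<in> I. s i = 1} = k}"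
      then have s: "s \<in> I \<rightarrow>\<^sub>E {-1, 1}"
        by blast
      show "(\<lambda>i\<in>I. if i \<in> {i \<in> I. s i = 1} then 1 else - 1) i = s i"
        \<comment> \<open>Outside \<open>I\<close> both sides are \<open>undefined\<close>.\<close>
        using PiE_mem[OF s, of i] PiE_arb[OF s, of i] by auto
    qed
  qed blast
  then have "card {s \<in> I \<rightarrow>\<^sub>E {-1, 1 :: real}. card {i \<in> I. s i = 1} = k}
               = card {P. P \<subseteq> I \<and> card P = k}"
    by (rule bij_betw_same_card)
  then show ?thesis
    by (simp add: n_subsets assms)
qed

text \<open>Only entry \<open>j\<close> lies off the support, so the norm condition bounds that
  entry alone, and the zero entry sum forces it to be minus the sum of the signs.\<close>

lemma recoverable_support_Compl_singleton_iff:
  fixes A :: "real^'n^'m"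
  assumes ker: "{x. A *v x = 0} = span {\<chi> i. 1}"
    and m: "CARD('m) = 2 * k" and n: "CARD('n) = 2 * k + 1"
  shows "recoverable_support A (UNIV - {j}) s \<longleftrightarrow>
           s \<in> (UNIV - {j}) \<rightarrow>\<^sub>E {-1, 1} \<and> card {i \<in> UNIV - {j}. s i = 1} = k"
proof (cases "s \<in> (UNIV - {j}) \<rightarrow>\<^sub>E {-1, 1}")
  case True
  let ?I = "UNIV - {j}"
  let ?pad = "\<lambda>v :: real^'n. \<chi> i. if i \<in> ?I then 0 else v $ i"
  have cardI: "card ?I = 2 * k"
    using n by simp
  have sum: "(\<Sum>i\<in>?I. s i) = 2 * real (card {i \<in> ?I. s i = 1}) - 2 * real k"
    using sum_signs[of ?I s] True by (simp add: cardI PiE_iff Pi_iff)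
  have split: "(\<Sum>i\<in>UNIV. v $ i) = v $ j + (\<Sum>i\<in>?I. v $ i)" for v :: "real^'n"
    by (simp add: sum.remove[of UNIV j])
  have "(\<exists>w. (\<forall>i\<in>?I. (transpose A *v w) $ i = s i) \<and> infnorm (?pad (transpose A *v w)) < 1)
          \<longleftrightarrow> card {i \<in> ?I. s i = 1} = k" (is "?L \<longleftrightarrow> ?R")
  proof
    assume ?L
    then obtain w where w: "\<And>i. i \<in> ?I \<Longrightarrow> (transpose A *v w) $ i = s i"
      and norm: "infnorm (?pad (transpose A *v w)) < 1"
      by blast
    have "(transpose A *v w) $ j + (\<Sum>i\<in>?I. s i) = 0"
      using in_range_transpose_iff[OF ker, of "transpose A *v w"] split[of "transpose A *v w"] w
      by simp
    moreover have "\<bar>(transpose A *v w) $ j\<bar> < 1"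
      using component_le_infnorm_cart[of "?pad (transpose A *v w)" j] norm by simp
    ultimately have "\<bar>2 * real (card {i \<in> ?I. s i = 1}) - 2 * real k\<bar> < 1"
      using sum by linarith
    \<comment> \<open>An integer whose double has modulus below one is zero.\<close>
    then show ?R
      by linarith
  next
    assume ?R
    \<comment> \<open>The signs are balanced, so the forced value at \<open>j\<close> is zero. Thus
      \<open>v\<close> has entry sum zero and lies in the range, and its padded version
      vanishes.\<close>
    define v :: "real^'n" where "v = (\<chi> i. if i = j then 0 else s i)"
    have "(\<Sum>i\<in>UNIV. v $ i) = 0"
      using \<open>?R\<close> sum by (simp add: split) (simp add: v_def)
    then have "v \<in> range ((*v) (transpose A))"
      by (simp only: in_range_transpose_iff[OF ker])
    then obtain w where w: "v = transpose A *v w"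
      by blast
    have "?pad v = 0"
      by (simp add: v_def vec_eq_iff)
    then have "(\<forall>i\<in>?I. v $ i = s i) \<and> infnorm (?pad v) < 1"
      by (simp only: infnorm_0) (simp add: v_def)
    then show ?L
      unfolding w by (rule exI)
  qed
  then show ?thesis
    using True cardI m full_rank_cols_Compl_singleton[OF ker, of j]
    unfolding recoverable_support_def by simp
qed (simp add: recoverable_support_def)

theorem mainTheorem5:
  fixes A :: "real^'n^'m" and n :: nat
  assumes "n \<ge> 3" and "odd n"
    and "CARD('n) = n" and "CARD('m) = n - 1"
    and "mercedes_benz_frame A"
  shows "real (num_recoverable_supports A (n - 1)) =
           ((real n + 1) / 2) * real (n choose ((n - 1) div 2))"
proof -
  obtain k where k: "n = 2 * k + 1"
    using \<open>odd n\<close> by (auto elim: oddE)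
  have ker: "{x. A *v x = 0} = span {\<chi> i. 1}"
    using assms(5) by (simp add: mercedes_benz_frame_def)
  have n: "CARD('n) = 2 * k + 1" and m: "CARD('m) = 2 * k"
    using assms(3,4) k by auto
  define S where "S = (\<lambda>j. {s \<in> (UNIV - {j :: 'n}) \<rightarrow>\<^sub>E {-1, 1 :: real}.
                              card {i \<in> UNIV - {j}. s i = 1} = k})"
  have rec: "recoverable_support A (UNIV - {j}) s \<longleftrightarrow> s \<in> S j" for j s
    by (simp add: recoverable_support_Compl_singleton_iff[OF ker m n] S_def)
  have finS: "finite (S j)" for j
    unfolding S_def by (intro finite_Collect_conjI disjI1) (simp add: finite_PiE)
  have cardS: "card (S j) = 2 * k choose k" for j
    using card_sign_vectors[of "UNIV - {j}" k] by (simp add: S_def n)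
  have card_2k: "(\<exists>j. I = UNIV - {j})" if "card I = 2 * k" for I :: "'n set"
  proof -
    have "card (- I) = 1"
      using that n by (simp add: Compl_eq_Diff_UNIV card_Diff_subset)
    then obtain j where "- I = {j}"
      by (auto simp: card_1_singleton_iff)
    then show ?thesis
      by blast
  qed
  \<comment> \<open>A support of size \<open>n - 1\<close> omits exactly one index \<open>j\<close>,
    so the pairs are parametrised by \<open>j\<close> and a balanced sign vector in
    \<open>S j\<close>.\<close>
  have "{(I, s). recoverable_support A I s \<and> card I = n - 1}
          = (\<lambda>(j, s). (UNIV - {j}, s)) ` Sigma UNIV S"
  proof (intro set_eqI iffI)
    fix p assume "p \<in> {(I, s). recoverable_support A I s \<and> card I = n - 1}"
    then obtain I s where p: "p = (I, s)" and I: "recoverable_support A I s" "card I = 2 * k"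
      by (auto simp: k)
    obtain j where "I = UNIV - {j}"
      using card_2k[OF I(2)] by blast
    then have "(j, s) \<in> Sigma UNIV S"
      using I(1) rec by blast
    then show "p \<in> (\<lambda>(j, s). (UNIV - {j}, s)) ` Sigma UNIV S"
      using p \<open>I = UNIV - {j}\<close> by (intro image_eqI[of _ _ "(j, s)"]) auto
  next
    fix p assume "p \<in> (\<lambda>(j, s). (UNIV - {j}, s)) ` Sigma UNIV S"
    then obtain j s where "p = (UNIV - {j}, s)" "s \<in> S j"
      by auto
    then show "p \<in> {(I, s). recoverable_support A I s \<and> card I = n - 1}"
      using n k rec[of j s] by simp
  qed
  moreover have "inj_on (\<lambda>(j, s). (UNIV - {j}, s)) (Sigma UNIV S)"
    by (auto simp: inj_on_def)
  ultimately have "num_recoverable_supports A (n - 1) = card (Sigma UNIV S)"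
    by (simp add: num_recoverable_supports_def card_image)
  also have "\<dots> = (\<Sum>j\<in>UNIV. card (S j))"
    by (intro card_SigmaI ballI finS) simp
  also have "\<dots> = n * (2 * k choose k)"
    by (simp add: cardS n k)
  \<comment> \<open>Absorption gives \<open>(n - k) * (n choose k) = n * ((n - 1) choose k)\<close>,
    where \<open>n - k = k + 1 = (n + 1) / 2\<close> and \<open>n - 1 = 2 * k\<close>.\<close>
  also have "\<dots> = (k + 1) * (n choose k)"
    using binomial_absorb_comp[of n k] by (simp add: k)
  finally show ?thesis
    by (simp add: k algebra_simps)
qed

end
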